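(* Let $(U^j)_{j\ge 0}$ be a solution of the explicit scheme that blows up at time $T_{h,\lambda}$. Then $$\max_{1 \le i \le N} u_i^j \sim (T_{h,\lambda} - t^j)^{-1/(p-1)} .$$ Moreover, $$\lim _{j \to \infty} \max_{1 \le i \le N} u_i^j\, (T_{h,\lambda} - t^j)^{1/(p-1)} = C_p = \left ( \frac{1}{p-1}\right )^{1/(p-1)} .$$
   Context: Let $N\ge 1$ be an integer and $p>1$ a real number. $M=\mathrm{diag}(m_1,\dots,m_N)$ is a diagonal matrix with $m_k>0$ for all $k$. $A=(a_{ik})$ is a real symmetric positive semidefinite $N\times N$ matrix with $a_{ik}\le 0$ for $i\neq k$, $a_{ii}>0$, and $\sum_{k=1}^N a_{ik}\ge 0$ for every $i$. All operations between vectors of $\mathbb{R}^N$ (in particular powers) are understood coordinate by coordinate. Explicit scheme: fix $\lambda>0$ and an initial vector $U^0\in\mathbb{R}^N$ with nonnegative entries, not all zero. For $j\ge 0$ write $U^j=(u_1^j,\dots,u_N^j)$, $w^j=\sum_{k=1}^N m_k u_k^j$, $\tau_j=\lambda/(w^j)^p$, $t^0=0$, $t^{j+1}=t^j+\tau_j$, and $$M U^{j+1}= M U^j + \tau_j \left (- AU^j + M (U^j)^p\right ).$$ Standing assumptions: $\lambda < \min_{1\le i \le N}\frac{m_i}{a_{ii}}(w^0)^p$, and the solutions considered have nonnegative entries with $w^j>0$ for all $j$. A solution blows up if $\lim_{j\to\infty}\|U^j\|_\infty=\infty$ and $T_{h,\lambda}:=\sum_{j=0}^\infty \tau_j<\infty$;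 $T_{h,\lambda}$ is its blow-up time (the indices $h,\lambda$ only record the dependence on the discretization). The notation $f(j)\sim g(j)$ means that there are constants $c,C>0$ independent of $j$ with $c\,g(j)\le f(j)\le C\,g(j)$; the constants may depend on all other data. *)

theory Defs
  imports "HOL-Analysis.Analysis"
begin

definition diag_matrix :: "real ^ 'n \<Rightarrow> real ^ 'n ^ 'n" where
  "diag_matrix m = (\<chi> i k. if i = k then m $ i else 0)"

definition pos_semidef :: "real ^ 'n ^ 'n \<Rightarrow> bool" where
  "pos_semidef A \<longleftrightarrow> (\<forall>x. 0 \<le> x \<bullet> (A *v x))"

text \<open>Coordinatewise real power; it is only used on vectors with nonnegative entries, where
  \<open>0 powr p = 0\<close> is the intended value.\<close>

definition vec_powr :: "real ^ 'n \<Rightarrow> real \<Rightarrow> real ^ 'n" where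
  "vec_powr u p = (\<chi> i. (u $ i) powr p)"

definition mass :: "real ^ 'n \<Rightarrow> real ^ 'n \<Rightarrow> real" where
  "mass m u = (\<Sum>k\<in>UNIV. m $ k * u $ k)"

definition time_step :: "real ^ 'n \<Rightarrow> real \<Rightarrow> real \<Rightarrow> (nat \<Rightarrow> real ^ 'n) \<Rightarrow> nat \<Rightarrow> real" where
  "time_step m p lam U j = lam / (mass m (U j)) powr p"

primrec time_at :: "real ^ 'n \<Rightarrow> real \<Rightarrow> real \<Rightarrow> (nat \<Rightarrow> real ^ 'n) \<Rightarrow> nat \<Rightarrow> real" where
  "time_at m p lam U 0 = 0"
| "time_at m p lam U (Suc j) = time_at m p lam U j + time_step m p lam U j"

definition explicit_scheme ::
    "real ^ 'n \<Rightarrow> real ^ 'n ^ 'n \<Rightarrow> real \<Rightarrow> real \<Rightarrow> (nat \<Rightarrow> real ^ 'n) \<Rightarrow> bool" where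
  "explicit_scheme m A p lam U \<longleftrightarrow>
    (\<forall>j. diag_matrix m *v U (Suc j) =
         diag_matrix m *v U j +
         time_step m p lam U j *\<^sub>R (- (A *v U j) + diag_matrix m *v vec_powr (U j) p))"

definition blows_up :: "real ^ 'n \<Rightarrow> real \<Rightarrow> real \<Rightarrow> (nat \<Rightarrow> real ^ 'n) \<Rightarrow> bool" where
  "blows_up m p lam U \<longleftrightarrow>
    filterlim (\<lambda>j. infnorm (U j)) at_top sequentially \<and> summable (time_step m p lam U)"

text \<open>Meaningful only for solutions that blow up, since \<open>suminf\<close> is unspecified for divergent series.\<close>

definition blow_up_time :: "real ^ 'n \<Rightarrow> real \<Rightarrow> real \<Rightarrow> (nat \<Rightarrow> real ^ 'n) \<Rightarrow> real" where
  "blow_up_time m p lam U = (\<Sum>j. time_step m p lam U j)"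

text \<open>Two-sided comparability for every index \<open>j\<close>, not merely for all large \<open>j\<close>.\<close>

definition comparable :: "(nat \<Rightarrow> real) \<Rightarrow> (nat \<Rightarrow> real) \<Rightarrow> bool" where
  "comparable f g \<longleftrightarrow> (\<exists>c>0. \<exists>C>0. \<forall>j. c * g j \<le> f j \<and> f j \<le> C * g j)"

end

theory Submission
  imports Defs
begin

text \<open>Write \<open>x\<^sub>j\<close> for the largest coordinate of \<open>U\<^sup>j\<close> and \<open>\<tau>\<^sub>j\<close> for the time step. The linear term
  \<open>A U\<close> is of lower order: it is bounded by a constant times \<open>x\<^sub>j\<close>, while the reaction term at a
  maximal coordinate is \<open>x\<^sub>j\<^sup>p\<close> with \<open>p > 1\<close>. Hence the maximum is an approximate explicit Euler
  solution of the ordinary differential equation \<open>x' = x\<^sup>p\<close>: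
  \<open>\<bar>x\<^sub>j\<^sub>+\<^sub>1 - x\<^sub>j - \<tau>\<^sub>j x\<^sub>j\<^sup>p\<bar> \<le> K \<tau>\<^sub>j x\<^sub>j\<close> (lemma \<open>Max_step_error\<close>).
  Moreover the mass is at least a constant times \<open>x\<^sub>j\<close>, so that \<open>\<tau>\<^sub>j x\<^sub>j\<^sup>p\<close> stays bounded
  (lemma \<open>time_step_powr_bound\<close>). Since \<open>x\<^sub>j\<close> tends to infinity, the
  increments of \<open>x\<close> are therefore negligible compared with \<open>x\<close> itself.

  The exact solution has \<open>x\<^sup>1\<^sup>-\<^sup>p\<close> affine in time, with slope \<open>1 - p\<close>. The discrete counterpart is
  \<open>(x\<^sub>j\<^sup>1\<^sup>-\<^sup>p - x\<^sub>j\<^sub>+\<^sub>1\<^sup>1\<^sup>-\<^sup>p) / \<tau>\<^sub>j \<longlonglongrightarrow> p - 1\<close>, which follows by differentiating \<open>r\<^sup>1\<^sup>-\<^sup>p\<close> at \<open>r = 1\<close>, because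
  \<open>x\<^sub>j\<^sub>+\<^sub>1 / x\<^sub>j \<longlonglongrightarrow> 1\<close>. Both \<open>x\<^sub>j\<^sup>1\<^sup>-\<^sup>p\<close> and \<open>T - t\<^sup>j\<close> tend to zero, so the Stolz-Cesaro theorem in its
  0/0 form (lemma \<open>stolz_cesaro_zero\<close>) sums these local rates to
  \<open>x\<^sub>j\<^sup>1\<^sup>-\<^sup>p / (T - t\<^sup>j) \<longlonglongrightarrow> p - 1\<close>, and taking the power \<open>- 1 / (p - 1)\<close> gives the limit. The two-sided
  estimate for all \<open>j\<close> follows, since a positive sequence with a positive limit is bounded and
  bounded away from zero.\<close>

section \<open>Asymptotics of sequences\<close>

text \<open>If the quotients of the increments are eventually below \<open>c\<close>, then \<open>c s - y\<close> is eventually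
  decreasing with limit zero, hence nonnegative; symmetrically for lower bounds.\<close>

lemma stolz_cesaro_zero:
  fixes y s :: "nat \<Rightarrow> real"
  assumes y0: "y \<longlonglongrightarrow> 0" and s0: "s \<longlonglongrightarrow> 0"
    and dec: "\<And>j. s (Suc j) < s j"
    and lim: "(\<lambda>j. (y j - y (Suc j)) / (s j - s (Suc j))) \<longlonglongrightarrow> L"
  shows "(\<lambda>j. y j / s j) \<longlonglongrightarrow> L"
proof -
  have spos: "s j > 0" for j
  proof -
    have "decseq s" using dec by (intro decseq_SucI less_imp_le)
    then have "s (Suc j) \<ge> 0" using s0 by (rule decseq_ge)
    then show ?thesis using dec[of j] by linarith
  qed
  have eventually_nonneg: "\<forall>\<^sub>F j in sequentially. z j \<ge> 0"
    if z0: "z \<longlonglongrightarrow> 0" and ev: "\<forall>\<^sub>F j in sequentially. z (Suc j) \<le> z j" for z :: "nat \<Rightarrow> real"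
  proof -
    obtain N where N: "\<And>j. j \<ge> N \<Longrightarrow> z (Suc j) \<le> z j"
      using ev unfolding eventually_sequentially by blast
    have "decseq (\<lambda>j. z (j + N))" using N by (intro decseq_SucI) simp
    then have "z (j + N) \<ge> 0" for j
      using LIMSEQ_ignore_initial_segment[OF z0, of N] by (rule decseq_ge)
    then show ?thesis
      unfolding eventually_sequentially by (metis le_add_diff_inverse2)
  qed
  show ?thesis
  proof (rule order_tendstoI)
    fix a assume "a < L"
    then obtain c where c: "a < c" "c < L" using dense by blast
    have "\<forall>\<^sub>F j in sequentially. c < (y j - y (Suc j)) / (s j - s (Suc j))"
      using order_tendstoD(1)[OF lim c(2)] .
    then have ev: "\<forall>\<^sub>F j in sequentially. y (Suc j) - c * s (Suc j) \<le> y j - c * s j"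
    proof eventually_elim
      case (elim j)
      then have "c * (s j - s (Suc j)) < y j - y (Suc j)"
        using dec[of j] by (simp add: pos_less_divide_eq)
      then show ?case by (simp add: algebra_simps)
    qed
    have "(\<lambda>j. y j - c * s j) \<longlonglongrightarrow> 0" using y0 s0 by (auto intro!: tendsto_eq_intros)
    from eventually_nonneg[OF this ev] show "\<forall>\<^sub>F j in sequentially. a < y j / s j"
    proof eventually_elim
      case (elim j)
      then have "c \<le> y j / s j" using spos[of j] by (simp add: pos_le_divide_eq)
      then show ?case using c by linarith
    qed
  next
    fix a assume "a > L"
    then obtain c where c: "c < a" "L < c" using dense by blast
    have "\<forall>\<^sub>F j in sequentially. (y j - y (Suc j)) / (s j - s (Suc j)) < c"
      using order_tendstoD(2)[OF lim c(2)] .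
    then have ev: "\<forall>\<^sub>F j in sequentially. c * s (Suc j) - y (Suc j) \<le> c * s j - y j"
    proof eventually_elim
      case (elim j)
      then have "y j - y (Suc j) < c * (s j - s (Suc j))"
        using dec[of j] by (simp add: pos_divide_less_eq)
      then show ?case by (simp add: algebra_simps)
    qed
    have "(\<lambda>j. c * s j - y j) \<longlonglongrightarrow> 0" using y0 s0 by (auto intro!: tendsto_eq_intros)
    from eventually_nonneg[OF this ev] show "\<forall>\<^sub>F j in sequentially. y j / s j < a"
    proof eventually_elim
      case (elim j)
      then have "y j / s j \<le> c" using spos[of j] by (simp add: pos_divide_le_eq)
      then show ?case using c by linarith
    qed
  qed
qed

lemma comparable_of_positive_limit:
  assumes gpos: "\<And>j. g j > 0" and fpos: "\<And>j. f j > 0"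
    and lim: "(\<lambda>j. f j / g j) \<longlonglongrightarrow> L" and L: "L > 0"
  shows "comparable f g"
proof -
  from lim obtain C where C: "C > 0" "\<And>j. norm (f j / g j) \<le> C"
    using convergent_imp_Bseq[of "\<lambda>j. f j / g j"] by (auto simp: convergent_def Bseq_def)
  have "(\<lambda>j. inverse (f j / g j)) \<longlonglongrightarrow> inverse L" using lim L by (intro tendsto_inverse) auto
  then obtain D where D: "D > 0" "\<And>j. norm (inverse (f j / g j)) \<le> D"
    using convergent_imp_Bseq[of "\<lambda>j. inverse (f j / g j)"] by (auto simp: convergent_def Bseq_def)
  have "inverse D * g j \<le> f j" for j
    using D(2)[of j] D(1) gpos[of j] fpos[of j] by (simp add: field_simps)
  moreover have "f j \<le> C * g j" for j
    using C(2)[of j] C(1) gpos[of j] fpos[of j] by (simp add: field_simps)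
  ultimately show ?thesis
    unfolding comparable_def using C(1) D(1) by (intro exI[of _ "inverse D"] conjI exI[of _ C]) auto
qed

section \<open>Perturbed Euler steps for a power nonlinearity\<close>

text \<open>The discrete analogue of \<open>x' = x\<^sup>p\<close>: the perturbation of size \<open>K \<tau> x\<close> has relative size
  \<open>K x\<^sup>1\<^sup>-\<^sup>p\<close>, which vanishes in the limit, and the bound on \<open>\<tau> x\<^sup>p\<close> makes the steps small
  compared with \<open>x\<close>. Without the latter bound a single step could multiply \<open>x\<close> by a fixed
  factor, and the Euler scheme would no longer follow the differential equation.\<close>

lemma blow_up_rate_perturbed_euler:
  fixes x \<tau> :: "nat \<Rightarrow> real" and p K C :: real
  assumes p: "p > 1"
    and xpos: "\<And>j. x j > 0" and xlim: "filterlim x at_top sequentially"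
    and tpos: "\<And>j. \<tau> j > 0" and summ: "summable \<tau>"
    and bounded: "\<And>j. \<tau> j * x j powr p \<le> C"
    and step: "\<And>j. \<bar>x (Suc j) - x j - \<tau> j * x j powr p\<bar> \<le> K * \<tau> j * x j"
  shows "(\<lambda>j. x j * (suminf \<tau> - (\<Sum>l<j. \<tau> l)) powr (1 / (p - 1)))
    \<longlonglongrightarrow> (1 / (p - 1)) powr (1 / (p - 1))"
proof -
  define s where "s j = suminf \<tau> - (\<Sum>l<j. \<tau> l)" for j
  define q where "q j = (x (Suc j) - x j) / (\<tau> j * x j powr p)" for j
  define r where "r j = x (Suc j) / x j" for j
  have s0: "s \<longlonglongrightarrow> 0"
    unfolding s_def using summable_LIMSEQ[OF summ] by (auto intro!: tendsto_eq_intros)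
  have s_step: "s j - s (Suc j) = \<tau> j" for j by (simp add: s_def)
  have s_dec: "s (Suc j) < s j" for j using tpos by (simp add: s_def)
  have spos: "s j > 0" for j
    unfolding s_def using sum_less_suminf[OF summ, of j] tpos by simp
  have y0: "(\<lambda>j. x j powr (1 - p)) \<longlonglongrightarrow> 0"
    using p by (intro tendsto_neg_powr[OF _ xlim]) simp
  have q_lim: "q \<longlonglongrightarrow> 1"
  proof (rule Lim_transform2)
    show "(\<lambda>j. 1 :: real) \<longlonglongrightarrow> 1" by simp
    have "(\<lambda>j. 1 - q j) \<longlonglongrightarrow> 0"
    proof (rule Lim_null_comparison)
      show "\<forall>\<^sub>F j in sequentially. norm (1 - q j) \<le> K * x j powr (1 - p)"
      proof (intro always_eventually allI)
        fix j
        have pos: "\<tau> j * x j powr p > 0" using tpos[of j] xpos[of j] by simp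
        have "1 - q j = - ((x (Suc j) - x j - \<tau> j * x j powr p) / (\<tau> j * x j powr p))"
          using less_imp_neq[OF pos] unfolding q_def diff_divide_distrib by simp
        then have "\<bar>1 - q j\<bar> = \<bar>x (Suc j) - x j - \<tau> j * x j powr p\<bar> / (\<tau> j * x j powr p)"
          using pos by (simp only: abs_minus_cancel abs_divide abs_of_pos)
        also have "\<dots> \<le> (K * \<tau> j * x j) / (\<tau> j * x j powr p)"
          using pos step[of j] by (intro divide_right_mono) auto
        also have "\<dots> = K * x j powr (1 - p)"
          using tpos[of j] xpos[of j] by (simp add: powr_diff)
        finally show "norm (1 - q j) \<le> K * x j powr (1 - p)" by simp
      qed
      show "(\<lambda>j. K * x j powr (1 - p)) \<longlonglongrightarrow> 0" using y0 by (rule tendsto_mult_right_zero)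
    qed
    then show "(\<lambda>j. 1 - q j) \<longlonglongrightarrow> 0" .
  qed
  have r_eq: "r j - 1 = q j * (\<tau> j * x j powr p) * inverse (x j)" for j
    using tpos[of j] xpos[of j] by (simp add: r_def q_def field_simps)
  have r_lim: "r \<longlonglongrightarrow> 1"
  proof -
    have inv0: "(\<lambda>j. inverse (x j)) \<longlonglongrightarrow> 0"
      using xlim by (rule tendsto_inverse_0_at_top)
    have "(\<lambda>j. (\<tau> j * x j powr p) * inverse (x j)) \<longlonglongrightarrow> 0"
    proof (rule Lim_null_comparison)
      show "\<forall>\<^sub>F j in sequentially. norm (\<tau> j * x j powr p * inverse (x j)) \<le> C * inverse (x j)"
        using bounded xpos less_imp_le[OF tpos]
        by (intro always_eventually allI) (auto simp: abs_mult abs_of_pos intro!: mult_right_mono less_imp_le[OF xpos])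
      show "(\<lambda>j. C * inverse (x j)) \<longlonglongrightarrow> 0" using inv0 by (rule tendsto_mult_right_zero)
    qed
    from tendsto_mult[OF q_lim this] have "(\<lambda>j. r j - 1) \<longlonglongrightarrow> 0"
      unfolding r_eq by (simp add: mult.assoc)
    then show ?thesis by (simp add: LIM_zero_iff)
  qed
  \<comment> \<open>The difference quotient below is taken at \<open>r \<noteq> 1\<close>; the sequence \<open>x\<close> is eventually strictly
    increasing, since the growth \<open>\<tau> x\<^sup>p\<close> outweighs the perturbation.\<close>
  have r_ne: "\<forall>\<^sub>F j in sequentially. r j \<noteq> 1"
    using order_tendstoD(1)[OF q_lim zero_less_one]
  proof eventually_elim
    case (elim j)
    then have "q j * (\<tau> j * x j powr p) * inverse (x j) > 0" using tpos[of j] xpos[of j] by simp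
    then show ?case using r_eq[of j] by auto
  qed
  have slope: "((\<lambda>t. (t powr (1 - p) - 1) / (t - 1)) \<longlongrightarrow> 1 - p) (at 1)"
  proof -
    have "((\<lambda>t. t powr (1 - p)) has_real_derivative (1 - p)) (at 1)"
      by (auto intro!: derivative_eq_intros)
    then show ?thesis by (simp add: has_field_derivative_iff)
  qed
  have r_at: "filterlim r (at 1) sequentially"
    using r_lim r_ne by (auto simp: filterlim_at)
  \<comment> \<open>The decrease of \<open>x\<^sup>1\<^sup>-\<^sup>p\<close> per unit of time factors into the difference quotient of \<open>r\<^sup>1\<^sup>-\<^sup>p\<close> and the
    relative accuracy \<open>q\<close> of the Euler step.\<close>
  have "(\<lambda>j. - ((r j powr (1 - p) - 1) / (r j - 1)) * q j) \<longlonglongrightarrow> - (1 - p) * 1"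
    by (intro tendsto_mult tendsto_minus q_lim filterlim_compose[OF slope r_at])
  then have rate: "(\<lambda>j. - ((r j powr (1 - p) - 1) / (r j - 1)) * q j) \<longlonglongrightarrow> p - 1"
    by simp
  have rate_eq: "\<forall>\<^sub>F j in sequentially. - ((r j powr (1 - p) - 1) / (r j - 1)) * q j
      = (x j powr (1 - p) - x (Suc j) powr (1 - p)) / (s j - s (Suc j))"
    using r_ne
  proof eventually_elim
    case (elim j)
    have x': "x (Suc j) = r j * x j" using xpos[of j] by (simp add: r_def)
    have rpos: "r j > 0" using xpos by (simp add: r_def)
    have q': "q j = (r j - 1) * x j powr (1 - p) / \<tau> j"
      using xpos[of j] tpos[of j] unfolding q_def x' powr_diff by (simp add: field_simps)
    have diff: "x j powr (1 - p) - x (Suc j) powr (1 - p) = - (r j powr (1 - p) - 1) * x j powr (1 - p)"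
      unfolding x' using rpos xpos[of j] by (simp add: powr_mult algebra_simps)
    have "- (a / (r j - 1)) * ((r j - 1) * y / \<tau> j) = - a * y / \<tau> j" for a y
      using elim by simp
    then show ?case unfolding s_step q' diff .
  qed
  have "(\<lambda>j. (x j powr (1 - p) - x (Suc j) powr (1 - p)) / (s j - s (Suc j))) \<longlonglongrightarrow> p - 1"
    using Lim_transform_eventually[OF rate rate_eq] .
  then have "(\<lambda>j. x j powr (1 - p) / s j) \<longlonglongrightarrow> p - 1"
    by (rule stolz_cesaro_zero[OF y0 s0 s_dec])
  then have "(\<lambda>j. (x j powr (1 - p) / s j) powr (- 1 / (p - 1))) \<longlonglongrightarrow> (p - 1) powr (- 1 / (p - 1))"
    using p by (intro tendsto_powr) auto
  moreover have "(x j powr (1 - p) / s j) powr (- 1 / (p - 1)) = x j * s j powr (1 / (p - 1))" for j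
  proof -
    have e: "(1 - p) * (- 1 / (p - 1)) = 1" using p by (simp add: field_simps)
    have "(x j powr (1 - p) / s j) powr (- 1 / (p - 1))
        = x j powr ((1 - p) * (- 1 / (p - 1))) / s j powr (- 1 / (p - 1))"
      using spos[of j] by (simp add: powr_divide powr_powr)
    also have "\<dots> = x j / s j powr (- (1 / (p - 1)))"
      unfolding e using xpos[of j] by simp
    also have "\<dots> = x j * s j powr (1 / (p - 1))"
      by (simp add: powr_minus divide_inverse)
    finally show ?thesis .
  qed
  moreover have "(p - 1) powr (- 1 / (p - 1)) = (1 / (p - 1)) powr (1 / (p - 1))"
    using p by (simp add: powr_minus powr_divide divide_inverse inverse_powr)
  ultimately show ?thesis by (simp add: s_def)
qed

section \<open>The largest coordinate of the explicit scheme\<close>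

lemma infnorm_nonneg_vector:
  fixes u :: "real ^ 'n"
  assumes "\<And>i. u $ i \<ge> 0"
  shows "infnorm u = (MAX i. u $ i)"
proof -
  have "{\<bar>u $ i\<bar> |i. i \<in> UNIV} = range (\<lambda>i. u $ i)" using assms by auto
  then show ?thesis by (simp add: infnorm_cart cSup_eq_Max)
qed

lemma explicit_scheme_component:
  fixes m :: "real ^ 'n"
  assumes "explicit_scheme m A p lam U" and "m $ i > 0"
  shows "U (Suc j) $ i = U j $ i + time_step m p lam U j * (U j $ i powr p - (A *v U j) $ i / m $ i)"
proof -
  have diag: "(diag_matrix m *v v) $ i = m $ i * v $ i" for v
    by (simp add: diag_matrix_def matrix_vector_mult_def if_distrib[of "\<lambda>t. t * _"] cong: if_cong)
  have "(diag_matrix m *v U (Suc j)) $ i = (diag_matrix m *v U j +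
      time_step m p lam U j *\<^sub>R (- (A *v U j) + diag_matrix m *v vec_powr (U j) p)) $ i"
    using assms(1) unfolding explicit_scheme_def by metis
  then have "m $ i * U (Suc j) $ i = m $ i * U j $ i
      + time_step m p lam U j * (- (A *v U j) $ i + m $ i * U j $ i powr p)"
    by (simp add: diag vec_powr_def)
  then show ?thesis using assms(2) by (simp add: field_simps)
qed

text \<open>Every coordinate of a nonnegative vector lies between zero and its maximum, so the linear
  term of the scheme is at most a constant times that maximum; as \<open>p > 1\<close>, this is of lower order
  than the reaction term.\<close>

lemma linear_term_bound:
  fixes A :: "real ^ 'n ^ 'n" and m u :: "real ^ 'n"
  assumes "m $ i > 0" and "\<And>k. 0 \<le> u $ k"
  shows "\<bar>(A *v u) $ i / m $ i\<bar> \<le> (\<Sum>i\<in>UNIV. (\<Sum>k\<in>UNIV. \<bar>A $ i $ k\<bar>) / \<bar>m $ i\<bar>) * (MAX i. u $ i)"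
proof -
  have max: "u $ k \<le> (MAX i. u $ i)" for k by simp
  then have max0: "0 \<le> (MAX i. u $ i)" using assms(2) order_trans by blast
  have "\<bar>(A *v u) $ i\<bar> \<le> (\<Sum>k\<in>UNIV. \<bar>A $ i $ k * u $ k\<bar>)"
    unfolding matrix_vector_mult_def by simp
  also have "\<dots> \<le> (\<Sum>k\<in>UNIV. \<bar>A $ i $ k\<bar> * (MAX i. u $ i))"
    using max assms(2) by (intro sum_mono) (simp add: abs_mult mult_left_mono)
  finally have "\<bar>(A *v u) $ i\<bar> / \<bar>m $ i\<bar> \<le> (\<Sum>k\<in>UNIV. \<bar>A $ i $ k\<bar>) * (MAX i. u $ i) / \<bar>m $ i\<bar>"
    by (intro divide_right_mono) (auto simp: sum_distrib_right)
  also have "\<dots> = (\<Sum>k\<in>UNIV. \<bar>A $ i $ k\<bar>) / \<bar>m $ i\<bar> * (MAX i. u $ i)" by simp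
  also have "\<dots> \<le> (\<Sum>i\<in>UNIV. (\<Sum>k\<in>UNIV. \<bar>A $ i $ k\<bar>) / \<bar>m $ i\<bar>) * (MAX i. u $ i)"
    using max0 by (intro mult_right_mono member_le_sum) (auto intro!: divide_nonneg_nonneg sum_nonneg)
  finally show ?thesis by simp
qed

text \<open>The map \<open>v \<mapsto> v + \<tau> v\<^sup>p\<close> is increasing for \<open>v \<ge> 0\<close>, so its largest value over the coordinates is attained at
  a maximal one; adding errors of size at most \<open>K \<tau> x\<close> moves the maximum by no more than that.
  The index at which the maximum sits may change from one step to the next.\<close>

lemma Max_step_error:
  fixes m :: "real ^ 'n" and A :: "real ^ 'n ^ 'n"
  assumes p: "p > 0" and m: "\<And>i. m $ i > 0"
    and scheme: "explicit_scheme m A p lam U"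
    and nonneg: "\<And>j i. U j $ i \<ge> 0"
    and tau: "time_step m p lam U j \<ge> 0"
  shows "\<bar>(MAX i. U (Suc j) $ i) - (MAX i. U j $ i)
      - time_step m p lam U j * (MAX i. U j $ i) powr p\<bar>
    \<le> (\<Sum>i\<in>UNIV. (\<Sum>k\<in>UNIV. \<bar>A $ i $ k\<bar>) / \<bar>m $ i\<bar>) * time_step m p lam U j * (MAX i. U j $ i)"
    (is "\<bar>?x' - ?x - ?t * _\<bar> \<le> ?K * ?t * ?x")
proof -
  have lin: "?t * \<bar>(A *v U j) $ i / m $ i\<bar> \<le> ?K * ?t * ?x" for i
    using mult_left_mono[OF linear_term_bound[OF m[of i] nonneg[of j], of A] tau] by (simp add: mult_ac)
  have err: "\<bar>U (Suc j) $ i - U j $ i - ?t * U j $ i powr p\<bar> \<le> ?K * ?t * ?x" for i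
  proof -
    have "U (Suc j) $ i - U j $ i - ?t * U j $ i powr p = - (?t * ((A *v U j) $ i / m $ i))"
      using explicit_scheme_component[OF scheme m, of j i] by (simp add: right_diff_distrib)
    then show ?thesis using lin[of i] tau by (simp add: abs_mult)
  qed
  have "?x' \<in> range (\<lambda>i. U (Suc j) $ i)" by (rule Max_in) auto
  then obtain a where a: "?x' = U (Suc j) $ a" by blast
  have "?x \<in> range (\<lambda>i. U j $ i)" by (rule Max_in) auto
  then obtain b where b: "?x = U j $ b" by blast
  have ax: "U j $ a \<le> ?x" by simp
  have "?t * U j $ a powr p \<le> ?t * ?x powr p"
    using p tau nonneg ax by (intro mult_left_mono powr_mono2) auto
  then have upper: "?x' - ?x - ?t * ?x powr p \<le> ?K * ?t * ?x"
    using err[of a] ax unfolding a by linarith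
  have "U (Suc j) $ b \<le> ?x'" by simp
  then have lower: "- (?K * ?t * ?x) \<le> ?x' - ?x - ?t * ?x powr p"
    using err[of b] unfolding b[symmetric] by linarith
  show ?thesis using upper lower by linarith
qed

text \<open>This is where the particular choice of step size enters: the mass dominates each single
  weighted coordinate.\<close>

lemma time_step_powr_bound:
  fixes m :: "real ^ 'n"
  assumes p: "p > 0" and lam: "lam > 0" and m: "\<And>i. m $ i > 0" and nonneg: "\<And>i. U j $ i \<ge> 0"
    and mass: "mass m (U j) > 0"
  shows "time_step m p lam U j * (MAX i. U j $ i) powr p \<le> lam / (MIN i. m $ i) powr p"
proof -
  let ?x = "MAX i. U j $ i"
  define c where "c = (MIN i. m $ i)"
  have c_le: "c \<le> m $ i" for i by (simp add: c_def)
  have c: "c > 0" using m by (simp add: c_def)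
  have "?x \<in> range (\<lambda>i. U j $ i)" by (rule Max_in) auto
  then obtain b where b: "?x = U j $ b" by blast
  have "c * ?x \<le> m $ b * U j $ b"
    unfolding b using nonneg[of b] by (intro mult_right_mono c_le)
  also have "\<dots> \<le> mass m (U j)"
    unfolding mass_def using nonneg less_imp_le[OF m]
    by (intro member_le_sum[where f = "\<lambda>k. m $ k * U j $ k"]) auto
  finally have "c * ?x \<le> mass m (U j)" .
  moreover have cx: "0 \<le> c * ?x" using c nonneg[of b] unfolding b by (intro mult_nonneg_nonneg) linarith+
  ultimately have "(c * ?x) powr p \<le> mass m (U j) powr p"
    using p cx by (intro powr_mono2) auto
  then have "c powr p * ?x powr p \<le> mass m (U j) powr p"
    using c nonneg b by (simp add: powr_mult)
  then have "lam * (c powr p * ?x powr p) \<le> lam * mass m (U j) powr p"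
    using lam by (intro mult_left_mono) auto
  then show ?thesis
    using c mass unfolding time_step_def c_def[symmetric] by (simp add: field_simps)
qed

lemma time_at_eq_sum: "time_at m p lam U j = (\<Sum>l<j. time_step m p lam U l)"
  by (induction j) auto

section \<open>The blow-up rate\<close>

theorem theorem2p2:
  fixes m :: "real ^ 'n" and A :: "real ^ 'n ^ 'n"
    and p lam T :: real and U :: "nat \<Rightarrow> real ^ 'n"
  assumes p: "p > 1"
    and m_pos: "\<forall>k. m $ k > 0"
    and A_sym: "transpose A = A"
    and A_psd: "pos_semidef A"
    and A_offdiag: "\<forall>i k. i \<noteq> k \<longrightarrow> A $ i $ k \<le> 0"
    and A_diag: "\<forall>i. A $ i $ i > 0"
    and A_rowsum: "\<forall>i. (\<Sum>k\<in>UNIV. A $ i $ k) \<ge> 0"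
    and lam_pos: "lam > 0"
    and U0_nonneg: "\<forall>i. U 0 $ i \<ge> 0"
    and U0_nonzero: "U 0 \<noteq> 0"
    and lam_less: "lam < (MIN i. m $ i / A $ i $ i) * (mass m (U 0)) powr p"
    and scheme: "explicit_scheme m A p lam U"
    and U_nonneg: "\<forall>j i. U j $ i \<ge> 0"
    and mass_pos: "\<forall>j. mass m (U j) > 0"
    and blow_up: "blows_up m p lam U"
    and T: "T = blow_up_time m p lam U"
  shows "comparable (\<lambda>j. MAX i. U j $ i) (\<lambda>j. (T - time_at m p lam U j) powr (- 1 / (p - 1)))
    \<and> (\<lambda>j. (MAX i. U j $ i) * (T - time_at m p lam U j) powr (1 / (p - 1)))
        \<longlonglongrightarrow> (1 / (p - 1)) powr (1 / (p - 1))"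
proof -
  let ?x = "\<lambda>j. MAX i. U j $ i"
  have m: "m $ k > 0" for k using m_pos by blast
  have nonneg: "U j $ i \<ge> 0" for j i using U_nonneg by blast
  have tpos: "time_step m p lam U j > 0" for j
    unfolding time_step_def using lam_pos mass_pos by (simp add: less_le)
  have summ: "summable (time_step m p lam U)" using blow_up unfolding blows_up_def by blast
  have xlim: "filterlim ?x at_top sequentially"
    using blow_up nonneg unfolding blows_up_def by (simp add: infnorm_nonneg_vector)
  have xpos: "?x j > 0" for j
  proof (rule ccontr)
    assume "\<not> ?x j > 0"
    moreover have "U j $ i \<le> ?x j" for i by simp
    ultimately have "U j $ i = 0" for i using nonneg[of j i] by (meson antisym not_less order_trans)
    then have "mass m (U j) = 0" by (simp add: mass_def)
    then show False using mass_pos by (metis less_irrefl)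
  qed
  have Tt: "T - time_at m p lam U j = suminf (time_step m p lam U) - (\<Sum>l<j. time_step m p lam U l)" for j
    unfolding T blow_up_time_def time_at_eq_sum ..
  have lim: "(\<lambda>j. ?x j * (T - time_at m p lam U j) powr (1 / (p - 1)))
      \<longlonglongrightarrow> (1 / (p - 1)) powr (1 / (p - 1))"
    unfolding Tt
  proof (rule blow_up_rate_perturbed_euler[OF p xpos xlim tpos summ])
    show "time_step m p lam U j * ?x j powr p \<le> lam / (MIN i. m $ i) powr p" for j
      using p mass_pos by (intro time_step_powr_bound lam_pos m nonneg) auto
    show "\<bar>?x (Suc j) - ?x j - time_step m p lam U j * ?x j powr p\<bar>
      \<le> (\<Sum>i\<in>UNIV. (\<Sum>k\<in>UNIV. \<bar>A $ i $ k\<bar>) / \<bar>m $ i\<bar>) * time_step m p lam U j * ?x j" for j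
      using p by (intro Max_step_error m scheme nonneg less_imp_le[OF tpos]) auto
  qed
  have rpos: "T - time_at m p lam U j > 0" for j
    unfolding Tt using sum_less_suminf[OF summ, of j] tpos by simp
  have "comparable ?x (\<lambda>j. (T - time_at m p lam U j) powr (- 1 / (p - 1)))"
  proof (rule comparable_of_positive_limit)
    show "(T - time_at m p lam U j) powr (- 1 / (p - 1)) > 0" for j using rpos[of j] by simp
    show "?x j > 0" for j by (rule xpos)
    show "(\<lambda>j. ?x j / (T - time_at m p lam U j) powr (- 1 / (p - 1)))
        \<longlonglongrightarrow> (1 / (p - 1)) powr (1 / (p - 1))"
      using lim by (simp add: powr_minus divide_inverse)
    show "(1 / (p - 1)) powr (1 / (p - 1)) > 0" using p by simp
  qed
  with lim show ?thesis by blast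
qed

end
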